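(* Let $\mathcal{A}$ be a real tensor of order $m$ and dimension $n$ such that every proper principal subtensor of $\mathcal{A}$ is a semi-positive tensor ($\mathbf{E_0}$-tensor). Then $\mathcal{A}$ is an almost semi-positive tensor (almost $\mathbf{E_0}$-tensor) if and only if there exists $\mathbf{x}\in\mathbb{R}^n$, $\mathbf{x}>\mathbf{0}$, such that $\mathbf{x}^{T}D(\mathcal{A}\mathbf{x}^{m-1})<0$ for every nonzero diagonal matrix $D\in\mathbb{R}^{n\times n}$ with all diagonal elements nonnegative.
   Context: A real tensor of order $m$ ($m\ge 2$) and dimension $n$ is an array $\mathcal{A}=(a_{i_1\ldots i_m})$ with $a_{i_1\ldots i_m}\in\mathbb{R}$, $i_1,\ldots,i_m\in I_n=\{1,\ldots,n\}$. For $\mathbf{x}\in\mathbb{R}^n$, $\mathcal{A}\mathbf{x}^{m-1}\in\mathbb{R}^n$ is defined by $(\mathcal{A}\mathbf{x}^{m-1})_i=\sum_{i_2,\ldots,i_m=1}^n a_{i i_2\ldots i_m}x_{i_2}\cdots x_{i_m}$. Vector inequalities are componentwise. For nonempty $J\subseteq I_n$, the principal subtensor of $\mathcal{A}$ indexed by $J$ is the tensor of order $m$ and dimension $|J|$ with entries $a_{i_1\ldots i_m}$, $i_1,\ldots,i_m\in J$; it is proper if $J\neq I_n$. $\mathcal{A}$ is semi-positive ($\mathbf{E_0}$-tensor) if for each $\mathbf{x}\ge\mathbf{0}$, $\mathbf{x}\ne\mathbf{0}$, there is $k\in I_n$ with $x_k>0$ and $(\mathcal{A}\mathbf{x}^{m-1})_k\ge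 0$. $\mathcal{A}$ is almost semi-positive (almost $\mathbf{E_0}$-tensor) if every proper principal subtensor of $\mathcal{A}$ is semi-positive and there is $\mathbf{x}>\mathbf{0}$ with $\mathcal{A}\mathbf{x}^{m-1}<\mathbf{0}$. *)

theory Defs
  imports "Jordan_Normal_Form.DL_Submatrix"
begin

text \<open>
  A real tensor of order m and dimension n is given by its entry function, which takes the list
  [i1, ..., im] of indices. Following the matrix library, indices are 0-based, so the index set is
  \<open>{0..<n}\<close>; only the entries at lists of length m over this set are meaningful, and all notions
  below depend on those entries only.
\<close>

type_synonym rtensor = "nat list \<Rightarrow> real"

definition index_lists :: "nat \<Rightarrow> nat \<Rightarrow> nat list set" where
  "index_lists k n = {is. length is = k \<and> set is \<subseteq> {0..<n}}"

definition tensor_app :: "nat \<Rightarrow> nat \<Rightarrow> rtensor \<Rightarrow> real vec \<Rightarrow> real vec" where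
  "tensor_app m n A x =
     vec n (\<lambda>i. \<Sum>is \<in> index_lists (m - 1) n. A (i # is) * prod_list (map (\<lambda>j. x $ j) is))"

text \<open>
  The library order \<open><\<close> on vectors is the strict part of \<open>\<le>\<close>, not the componentwise strict order,
  which is therefore introduced separately.
\<close>

definition vec_slt :: "real vec \<Rightarrow> real vec \<Rightarrow> bool" (infix "<\<^sub>v" 50) where
  "x <\<^sub>v y \<longleftrightarrow> dim_vec x = dim_vec y \<and> (\<forall>i < dim_vec y. x $ i < y $ i)"

text \<open>
  As for \<open>submatrix\<close>, the principal subtensor indexed by J is re-indexed by \<open>{0..<card J}\<close> along the
  increasing enumeration \<open>pick J\<close> of J.
\<close>

definition principal_subtensor :: "rtensor \<Rightarrow> nat set \<Rightarrow> rtensor" where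
  "principal_subtensor A J = (\<lambda>is. A (map (pick J) is))"

definition semi_positive :: "nat \<Rightarrow> nat \<Rightarrow> rtensor \<Rightarrow> bool" where
  "semi_positive m n A \<longleftrightarrow>
     (\<forall>x \<in> carrier_vec n. 0\<^sub>v n \<le> x \<and> x \<noteq> 0\<^sub>v n \<longrightarrow>
        (\<exists>k<n. x $ k > 0 \<and> tensor_app m n A x $ k \<ge> 0))"

definition proper_subtensors_semi_positive :: "nat \<Rightarrow> nat \<Rightarrow> rtensor \<Rightarrow> bool" where
  "proper_subtensors_semi_positive m n A \<longleftrightarrow>
     (\<forall>J. J \<noteq> {} \<and> J \<subset> {0..<n} \<longrightarrow> semi_positive m (card J) (principal_subtensor A J))"

definition almost_semi_positive :: "nat \<Rightarrow> nat \<Rightarrow> rtensor \<Rightarrow> bool" where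
  "almost_semi_positive m n A \<longleftrightarrow>
     proper_subtensors_semi_positive m n A \<and>
     (\<exists>x \<in> carrier_vec n. 0\<^sub>v n <\<^sub>v x \<and> tensor_app m n A x <\<^sub>v 0\<^sub>v n)"

end

theory Submission
  imports Defs
begin

text \<open>
  Only the existence of a positive vector x is at stake, and the two conditions on x are equivalent
  for each x separately. With \<open>y = \<A>x\<^sup>m\<^sup>-\<^sup>1\<close>, the quantity \<open>x\<^sup>TDy\<close> is the weighted sum of the
  \<open>x\<^sub>iy\<^sub>i\<close> with the diagonal entries of D as weights. If \<open>y < 0\<close>, every summand is nonpositive
  and one with a nonzero weight is negative; conversely, the matrix whose only nonzero entry is a 1
  in diagonal position k isolates \<open>x\<^sub>ky\<^sub>k\<close>, whose negativity gives \<open>y\<^sub>k < 0\<close>. The fact about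
  vectors x and y is \<open>vec_slt_zero_iff_diagonal\<close>.
\<close>

lemma scalar_prod_diagonal_mat_mult:
  fixes x y :: "'a :: comm_semiring_1 vec"
  assumes D: "D \<in> carrier_mat n n" "diagonal_mat D"
    and x: "x \<in> carrier_vec n" and y: "y \<in> carrier_vec n"
  shows "x \<bullet> (D *\<^sub>v y) = (\<Sum>i<n. D $$ (i, i) * (x $ i * y $ i))"
proof -
  have "(D *\<^sub>v y) $ i = D $$ (i, i) * y $ i" if i: "i < n" for i
  proof -
    have "(D *\<^sub>v y) $ i = (\<Sum>j<n. D $$ (i, j) * y $ j)"
      using D(1) y i by (simp add: scalar_prod_def lessThan_atLeast0)
    also have "\<dots> = (\<Sum>j<n. if j = i then D $$ (i, i) * y $ i else 0)"
      using D i by (intro sum.cong) (auto simp: diagonal_mat_def)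
    finally show ?thesis
      using i by simp
  qed
  then show ?thesis
    using D(1) x by (auto simp: scalar_prod_def lessThan_atLeast0 mult_ac intro!: sum.cong)
qed

lemma vec_slt_zero_iff_diagonal:
  assumes x: "x \<in> carrier_vec n" "0\<^sub>v n <\<^sub>v x" and y: "y \<in> carrier_vec n"
  shows "y <\<^sub>v 0\<^sub>v n \<longleftrightarrow>
    (\<forall>D \<in> carrier_mat n n.
       diagonal_mat D \<and> D \<noteq> 0\<^sub>m n n \<and> (\<forall>i<n. D $$ (i, i) \<ge> 0) \<longrightarrow> x \<bullet> (D *\<^sub>v y) < 0)"
    (is "_ \<longleftrightarrow> ?R")
proof
  have x_pos: "x $ i > 0" if "i < n" for i
    using x that by (auto simp: vec_slt_def)
  {
    assume "y <\<^sub>v 0\<^sub>v n"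
    then have neg: "x $ i * y $ i < 0" if "i < n" for i
      using x_pos that by (auto simp: vec_slt_def intro: mult_pos_neg)
    show ?R
    proof (intro ballI impI, elim conjE)
      fix D :: "real mat"
      assume D: "D \<in> carrier_mat n n" "diagonal_mat D" "D \<noteq> 0\<^sub>m n n"
        and nonneg: "\<forall>i<n. D $$ (i, i) \<ge> 0"
      obtain k where k: "k < n" "D $$ (k, k) \<noteq> 0"
      proof -
        obtain i j where "i < n" "j < n" "D $$ (i, j) \<noteq> 0"
          using D(1,3) by (auto simp: mat_eq_iff)
        then show ?thesis
          using D(1,2) that by (cases "i = j") (auto simp: diagonal_mat_def)
      qed
      have "(\<Sum>i<n. D $$ (i, i) * (x $ i * y $ i)) < (\<Sum>i<n. 0)"
      proof (rule sum_strict_mono_ex1)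
        show "\<forall>i\<in>{..<n}. D $$ (i, i) * (x $ i * y $ i) \<le> 0"
          using nonneg neg by (simp add: mult_nonneg_nonpos order.strict_implies_order)
        have "D $$ (k, k) > 0"
          using nonneg k by (simp add: order_less_le)
        then show "\<exists>i\<in>{..<n}. D $$ (i, i) * (x $ i * y $ i) < 0"
          using neg k(1) by (intro bexI[of _ k]) (auto intro: mult_pos_neg)
      qed simp
      then show "x \<bullet> (D *\<^sub>v y) < 0"
        using scalar_prod_diagonal_mat_mult[OF D(1,2) x(1) y] by simp
    qed
  next
    assume R: ?R
    have "y $ k < 0" if k: "k < n" for k
    proof -
      define D :: "real mat" where "D = mat n n (\<lambda>(i, j). if i = k \<and> j = k then 1 else 0)"
      have D: "D \<in> carrier_mat n n" "diagonal_mat D"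
        by (auto simp: D_def diagonal_mat_def)
      have "D $$ (k, k) \<noteq> 0\<^sub>m n n $$ (k, k)"
        using k by (simp add: D_def)
      then have "D \<noteq> 0\<^sub>m n n"
        by metis
      moreover have "\<forall>i<n. D $$ (i, i) \<ge> 0"
        by (simp add: D_def)
      ultimately have "x \<bullet> (D *\<^sub>v y) < 0"
        using R D by blast
      also have "x \<bullet> (D *\<^sub>v y) = (\<Sum>i<n. if i = k then x $ k * y $ k else 0)"
        unfolding scalar_prod_diagonal_mat_mult[OF D x(1) y]
        by (intro sum.cong) (auto simp: D_def)
      also have "\<dots> = x $ k * y $ k"
        using k by simp
      finally show ?thesis
        using x_pos[OF k] by (simp add: mult_less_0_iff)
    qed
    then show "y <\<^sub>v 0\<^sub>v n"
      using y by (simp add: vec_slt_def)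
  }
qed

theorem theorem9:
  fixes A :: rtensor and m n :: nat
  assumes "m \<ge> 2" and "n \<ge> 1"
    and "proper_subtensors_semi_positive m n A"
  shows "almost_semi_positive m n A \<longleftrightarrow>
    (\<exists>x \<in> carrier_vec n. 0\<^sub>v n <\<^sub>v x \<and>
       (\<forall>D \<in> carrier_mat n n.
          diagonal_mat D \<and> D \<noteq> 0\<^sub>m n n \<and> (\<forall>i<n. D $$ (i, i) \<ge> 0) \<longrightarrow>
          x \<bullet> (D *\<^sub>v tensor_app m n A x) < 0))"
proof -
  have "tensor_app m n A x \<in> carrier_vec n" for x
    by (simp add: tensor_app_def)
  then show ?thesis
    unfolding almost_semi_positive_def
    using assms(3) vec_slt_zero_iff_diagonal by blast
qed

end
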